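(* Let $m \ge 3$ be odd and $n = 3^m-1$. Then the ternary cyclic code $\mathcal{C}_{(0,1,m)}$ has parameters $[n,k,d]$ with $d \ge \frac{3^{(m-1)/2}+13}{2}$ if $m \equiv 1 \pmod 4$ and $d \ge \frac{3^{(m-1)/2}+11}{2}$ if $m \equiv 3 \pmod 4$, and $k = \frac{n}{2}$ if $m \equiv 1 \pmod 4$ and $k = \frac{n+2}{2}$ if $m \equiv 3 \pmod 4$.
   Context: Let $m \ge 2$ be an integer, $n = 3^m-1$, and let $\alpha$ be a primitive element of $\mathbb{F}_{3^m}$. For an integer $0 \le j \le n-1$ with $3$-adic expansion $j = \sum_{t=0}^{m-1} j_t 3^t$, $j_t \in \{0,1,2\}$, let $w_3(j) = \sum_{t=0}^{m-1} j_t$. For distinct $i_1, i_2 \in \{0,1,2,3\}$ let $T_{(i_1,i_2,m)} = \{1 \le j \le n-1 : w_3(j) \equiv i_1 \text{ or } i_2 \pmod 4\}$ and $g_{(i_1,i_2,m)}(x) = \prod_{j \in T_{(i_1,i_2,m)}} (x - \alpha^j) \in \mathbb{F}_3[x]$. $\mathcal{C}_{(i_1,i_2,m)}$ denotes the ternary cyclic code of length $n$ with generator polynomial $g_{(i_1,i_2,m)}(x)$. Parameters $[n,k,d]$ mean length, dimension over $\mathbb{F}_3$, and minimum Hamming distance. *)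

theory Defs
  imports "HOL-Computational_Algebra.Polynomial" "HOL-Library.Cardinality"
begin

fun w3 :: "nat \<Rightarrow> nat" where
  "w3 j = (if j = 0 then 0 else j mod 3 + w3 (j div 3))"

text \<open>The prime subfield F_3 inside a field 'a of characteristic 3.\<close>
definition prime_subfield :: "'a::field set" where
  "prime_subfield = {x. \<exists>i::int. x = of_int i}"

definition primitive_element :: "'a::field \<Rightarrow> bool" where
  "primitive_element \<alpha> \<longleftrightarrow> (\<forall>x. x \<noteq> 0 \<longrightarrow> (\<exists>i::nat. x = \<alpha> ^ i))"

definition T_set :: "nat \<Rightarrow> nat \<Rightarrow> nat \<Rightarrow> nat set" where
  "T_set i1 i2 m = {j. 1 \<le> j \<and> j \<le> 3^m - 2 \<and> (w3 j mod 4 = i1 \<or> w3 j mod 4 = i2)}"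

definition gen_poly :: "'a::field \<Rightarrow> nat \<Rightarrow> nat \<Rightarrow> nat \<Rightarrow> 'a poly" where
  "gen_poly \<alpha> i1 i2 m = (\<Prod>j\<in>T_set i1 i2 m. [:- (\<alpha> ^ j), 1:])"

text \<open>Cyclic code of length n over F_3 generated by g: codewords are polynomials
  of degree < n with coefficients in F_3 (elements of F_3[x]/(x^n-1)) divisible by g.\<close>
definition cyclic_code :: "nat \<Rightarrow> 'a::field poly \<Rightarrow> 'a poly set" where
  "cyclic_code n g = {c. degree c < n \<and> (\<forall>i. coeff c i \<in> prime_subfield) \<and> g dvd c}"

definition hamming_weight :: "'a::zero poly \<Rightarrow> nat" where
  "hamming_weight c = card {i. coeff c i \<noteq> 0}"

definition min_distance :: "'a::zero poly set \<Rightarrow> nat" where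
  "min_distance C = Min (hamming_weight ` (C - {0}))"

end

theory Submission
  imports Defs "HOL-Library.FuncSet" "HOL-Computational_Algebra.Primes"
begin

text \<open>The digit sum \<open>w\<^sub>3\<close> preserves parity, so the even zeros of the code are the exponents of weight
  0 modulo 4 and the odd zeros those of weight 1. Write \<open>m = 2h + 1\<close> and let \<open>k\<close> be the even one of
  \<open>h\<close>, \<open>h + 1\<close>. The multiples \<open>(3\<^sup>k - 1) i\<close> with \<open>1 \<le> i \<le> 3\<^sup>k\<close> all have weight \<open>2k\<close>, and
  \<open>gcd (3\<^sup>k - 1, n) = 2\<close>. This gives a run of \<open>3\<^sup>h\<close> even zeros and, after adding \<open>3\<^bsup>2h\<^esup>\<close>, a run of
  \<open>2 \<cdot> 3\<^bsup>h-1\<^esup>\<close> odd zeros, each inside a progression that exhausts its parity class. A BCH-type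
  argument bounds the weight of a word that does not vanish on all even powers of \<open>\<alpha>\<close>; a word that
  does is \<open>(x\<^bsup>n/2\<^esup> - 1) q\<close>, of twice the weight of \<open>q\<close>. For \<open>m = 3\<close> these runs are too short and the
  shifting bound of van Lint and Wilson is used instead.

  For the dimension, the number \<open>N\<^sub>r(p)\<close> of \<open>p\<close>-digit numbers of weight \<open>r\<close> modulo 4 satisfies
  \<open>N\<^sub>r(p + 1) = 3\<^sup>p - N\<^sub>r\<^sub>+\<^sub>1(p)\<close>.\<close>

declare w3.simps [simp del]

section \<open>Ternary digit sums\<close>

lemma w3_0 [simp]: "w3 0 = 0"
  by (simp add: w3.simps)

lemma w3_digit: "a < 3 \<Longrightarrow> w3 a = a"
  by (subst w3.simps) simp

lemma w3_cons: "d < 3 \<Longrightarrow> w3 (3 * q + d) = w3 q + d"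
  by (subst w3.simps) auto

lemma w3_block:
  assumes "r < 3 ^ p"
  shows "w3 (q * 3 ^ p + r) = w3 q + w3 r"
  using assms
proof (induction p arbitrary: r)
  case (Suc p)
  have r: "r div 3 < 3 ^ p" using Suc.prems by (simp add: less_mult_imp_div_less mult.commute)
  have "q * 3 ^ Suc p + r = 3 * (q * 3 ^ p + r div 3) + r mod 3"
    by (simp add: algebra_simps)
  then have "w3 (q * 3 ^ Suc p + r) = w3 (q * 3 ^ p + r div 3) + r mod 3"
    by (simp only: w3_cons[of "r mod 3"] mod_less_divisor zero_less_numeral)
  also have "\<dots> = w3 q + (w3 (r div 3) + r mod 3)"
    using Suc.IH[OF r] by simp
  also have "w3 (r div 3) + r mod 3 = w3 r"
    using w3_cons[of "r mod 3" "r div 3"] by simp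
  finally show ?case .
qed simp

text \<open>Subtracting from \<open>3 ^ p - 1\<close>, all of whose digits are 2, needs no
  borrowing: each digit \<open>d\<close> becomes \<open>2 - d\<close>.\<close>

lemma w3_complement:
  assumes "r < 3 ^ p"
  shows "w3 (3 ^ p - 1 - r) + w3 r = 2 * p"
  using assms
proof (induction p arbitrary: r)
  case (Suc p)
  define q d where "q = r div 3" and "d = r mod 3"
  have r: "r = 3 * q + d" and d: "d < 3" by (simp_all add: q_def d_def)
  have q: "q < 3 ^ p" using Suc.prems r by simp
  have "3 ^ Suc p - 1 - r = 3 * (3 ^ p - 1 - q) + (2 - d)"
    using q d by (simp add: r)
  then have "w3 (3 ^ Suc p - 1 - r) = w3 (3 ^ p - 1 - q) + (2 - d)"
    using w3_cons[of "2 - d" "3 ^ p - 1 - q"] by simp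
  then show ?case using Suc.IH[OF q] w3_cons[OF d, of q] d by (simp add: r)
qed simp

text \<open>The product is \<open>(i - 1) * 3 ^ k + (3 ^ k - 1 - (i - 1))\<close>: its low block is
  the digitwise complement of its high block, so the weight does not depend on
  \<open>i\<close>.\<close>

lemma w3_mult_power_minus_1:
  assumes "1 \<le> i" "i \<le> 3 ^ k"
  shows "w3 ((3 ^ k - 1) * i) = 2 * k"
proof -
  have "(3 ^ k - 1) * i = (i - 1) * 3 ^ k + (3 ^ k - 1 - (i - 1))"
  proof -
    obtain i' where i: "i = Suc i'" using assms by (cases i) auto
    obtain z where z: "(3::nat) ^ k = Suc i' + z" using assms i le_Suc_ex by metis
    show ?thesis unfolding i z by (simp add: algebra_simps)
  qed
  moreover have "w3 (3 ^ k - 1 - (i - 1)) + w3 (i - 1) = 2 * k"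
    by (rule w3_complement) (use assms in linarith)
  moreover have "w3 ((i - 1) * 3 ^ k + (3 ^ k - 1 - (i - 1)))
      = w3 (i - 1) + w3 (3 ^ k - 1 - (i - 1))"
    by (rule w3_block) (simp add: less_imp_diff_less)
  ultimately show ?thesis by simp
qed

text \<open>The digit of \<open>x\<close> at position \<open>p\<close> is 0 or 1 and nothing lies
  above it, so the addition causes no carry.\<close>

lemma w3_add_power:
  assumes "x < 2 * 3 ^ p"
  shows "w3 (3 ^ p + x) = Suc (w3 x)"
proof -
  define q r where "q = x div 3 ^ p" and "r = x mod 3 ^ p"
  have x: "x = q * 3 ^ p + r" unfolding q_def r_def by (rule div_mult_mod_eq[symmetric])
  have r: "r < 3 ^ p" by (simp add: r_def)
  have q: "q < 2" using assms by (simp add: q_def less_mult_imp_div_less)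
  have "w3 (3 ^ p + x) = w3 (Suc q * 3 ^ p + r)" by (simp add: x ac_simps)
  also have "\<dots> = Suc q + w3 r" using w3_block[OF r, of "Suc q"] q by (simp add: w3_digit)
  also have "\<dots> = Suc (w3 x)" using w3_block[OF r, of q] q by (simp add: x w3_digit)
  finally show ?thesis .
qed

section \<open>Counting numbers by digit sum modulo 4\<close>

text \<open>Reducing \<open>r\<close> modulo 4 inside the set lets the recurrence pass from
  \<open>r\<close> to \<open>Suc r\<close> without wrap-around.\<close>

definition w3_count :: "nat \<Rightarrow> nat \<Rightarrow> nat" where
  "w3_count r p = card {j. j < 3 ^ p \<and> w3 j mod 4 = r mod 4}"

lemma w3_count_mod: "w3_count (r + 4) p = w3_count r p"
  by (simp add: w3_count_def)

lemma digit_unique: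
  fixes a d e :: nat
  assumes "(a + d) mod 4 = (a + e) mod 4" "d < 3" "e < 3"
  shows "d = e"
proof -
  have "int 4 dvd (int (a + d) - int (a + e))" using assms(1) by (metis mod_eq_dvd_iff of_nat_mod)
  then show ?thesis using assms(2,3) by simp presburger
qed

text \<open>The only candidate modulo 4 is \<open>r - a\<close>, and the one residue that is not a
  ternary digit is 3.\<close>

lemma digit_exists_iff:
  fixes a r :: nat
  shows "(\<exists>d<3. (a + d) mod 4 = r mod 4) \<longleftrightarrow> a mod 4 \<noteq> Suc r mod 4"
proof (intro iffI notI; (elim exE conjE)?)
  fix d assume d: "d < 3" "(a + d) mod 4 = r mod 4" "a mod 4 = Suc r mod 4"
  then have "(Suc r + d) mod 4 = r mod 4" by (metis mod_add_left_eq)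
  then have "(r + Suc d) mod 4 = (r + 0) mod 4" by simp
  then have "int 4 dvd (int (r + Suc d) - int (r + 0))" by (metis mod_eq_dvd_iff of_nat_mod)
  then show False using d(1) by simp presburger
next
  assume a: "a mod 4 \<noteq> Suc r mod 4"
  \<comment> \<open>This is \<open>r - a\<close> modulo 4, since 3 is -1 there.\<close>
  define d where "d = (r + 3 * a) mod 4"
  have "(a + d) mod 4 = (r + 4 * a) mod 4" by (simp add: d_def mod_add_right_eq)
  then have d: "(a + d) mod 4 = r mod 4" by simp
  have "d \<noteq> 3"
  proof
    assume "d = 3"
    then have "Suc (a + 3) mod 4 = Suc r mod 4" using d by (metis mod_Suc_eq)
    then show False using a by simp
  qed
  moreover have "d < 4" by (simp add: d_def)
  ultimately show "\<exists>d<3. (a + d) mod 4 = r mod 4" using d by (intro exI[of _ d]) auto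
qed

text \<open>Exactly one last digit completes a number of weight \<open>w\<close> to one of weight \<open>r\<close> modulo 4,
  unless \<open>w\<close> is \<open>r + 1\<close> modulo 4.\<close>

lemma w3_count_Suc: "w3_count r (Suc p) + w3_count (Suc r) p = 3 ^ p"
proof -
  let ?A = "{j. j < 3 ^ Suc p \<and> w3 j mod 4 = r mod 4}"
  let ?B = "{q. q < 3 ^ p \<and> w3 q mod 4 = Suc r mod 4}"
  have w: "w3 j = w3 (j div 3) + j mod 3" for j
    using w3_cons[of "j mod 3" "j div 3"] by simp
  have inj: "inj_on (\<lambda>j. j div 3) ?A"
  proof (rule inj_onI)
    fix x y assume xy: "x \<in> ?A" "y \<in> ?A" "x div 3 = y div 3"
    then have "w3 x mod 4 = w3 y mod 4" by simp
    then have "(w3 (x div 3) + x mod 3) mod 4 = (w3 (x div 3) + y mod 3) mod 4"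
      by (simp only: w[of x] w[of y] xy(3))
    then have "x mod 3 = y mod 3" by (rule digit_unique) simp_all
    then show "x = y" using xy(3) by (metis div_mult_mod_eq)
  qed
  have "(\<lambda>j. j div 3) ` ?A = {..<3 ^ p} - ?B"
  proof (intro equalityI subsetI)
    fix q assume "q \<in> (\<lambda>j. j div 3) ` ?A"
    then obtain j where j: "j < 3 ^ Suc p" "w3 j mod 4 = r mod 4" "q = j div 3" by auto
    have "(w3 q + j mod 3) mod 4 = r mod 4" using j w[of j] by simp
    then have "w3 q mod 4 \<noteq> Suc r mod 4" using digit_exists_iff[of "w3 q" r] by force
    moreover have "q < 3 ^ p" using j by (simp add: less_mult_imp_div_less mult.commute)
    ultimately show "q \<in> {..<3 ^ p} - ?B" by simp
  next
    fix q assume "q \<in> {..<3 ^ p} - ?B"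
    then have q: "q < 3 ^ p" "w3 q mod 4 \<noteq> Suc r mod 4" by auto
    then have "\<exists>d<3. (w3 q + d) mod 4 = r mod 4" using digit_exists_iff[of "w3 q" r] by simp
    then obtain d where d: "d < 3" "(w3 q + d) mod 4 = r mod 4" by blast
    have "3 * q + d \<in> ?A" using q d w3_cons[of d q] by simp
    moreover have "(3 * q + d) div 3 = q" using d by simp
    ultimately show "q \<in> (\<lambda>j. j div 3) ` ?A" by force
  qed
  then have "card ?A = card ({..<3 ^ p} - ?B)" using card_image[OF inj] by simp
  also have "\<dots> = 3 ^ p - card ?B" by (subst card_Diff_subset) auto
  finally have "w3_count r (Suc p) = 3 ^ p - w3_count (Suc r) p" by (simp add: w3_count_def)
  moreover have "card ?B \<le> card {..<3 ^ p :: nat}" by (intro card_mono) auto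
  then have "w3_count (Suc r) p \<le> 3 ^ p" by (simp add: w3_count_def)
  ultimately show ?thesis by simp
qed

lemma w3_count_0: "w3_count r 0 = (if r mod 4 = 0 then 1 else 0)"
proof -
  have "{j. j < 3 ^ 0 \<and> w3 j mod 4 = r mod 4} = (if r mod 4 = 0 then {0} else {})" by auto
  then show ?thesis by (simp add: w3_count_def)
qed

lemma w3_count_total: "w3_count 0 p + w3_count 1 p + w3_count 2 p + w3_count 3 p = 3 ^ p"
proof (induction p)
  case (Suc p)
  show ?case
    using Suc w3_count_Suc[of 0 p] w3_count_Suc[of 1 p] w3_count_Suc[of 2 p]
      w3_count_Suc[of 3 p] w3_count_mod[of 0 p] by (simp add: numeral_eq_Suc)
qed (simp add: w3_count_0)

text \<open>Two uses of the recurrence turn the sum \<open>s\<close> of both counts at length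
  \<open>p\<close> into \<open>5 * 3 ^ p - s\<close> at length \<open>p + 2\<close>. Hence the
  deviation of \<open>2 * s\<close> from \<open>3 ^ p\<close> only changes its sign.\<close>

lemma w3_count_01:
  "2 * (int (w3_count 0 (2 * h + 1)) + int (w3_count 1 (2 * h + 1))) = 3 ^ (2 * h + 1) + (-1) ^ h"
proof (induction h)
  case 0
  show ?case using w3_count_Suc[of 0 0] w3_count_Suc[of 1 0] by (simp add: w3_count_0)
next
  case (Suc h)
  let ?p = "2 * h + 1" and ?c = "\<lambda>r p. int (w3_count r p)"
  have rec: "?c r (Suc p) + ?c (Suc r) p = 3 ^ p" for r p
    using w3_count_Suc[of r p] by (metis of_nat_add of_nat_numeral of_nat_power)
  have tot: "?c 0 ?p + ?c 1 ?p + ?c 2 ?p + ?c 3 ?p = 3 ^ ?p"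
    using w3_count_total[of ?p] by (metis of_nat_add of_nat_numeral of_nat_power)
  have "?c 0 (Suc (Suc ?p)) + ?c 1 (Suc (Suc ?p)) = 5 * 3 ^ ?p - (?c 0 ?p + ?c 1 ?p)"
    using rec[of 0 "Suc ?p"] rec[of 1 "Suc ?p"] rec[of 1 ?p] rec[of 2 ?p] tot
    by (simp add: numeral_eq_Suc)
  with Suc show ?case by simp
qed

lemma finite_T_set [simp]: "finite (T_set i1 i2 m)"
  by (rule finite_subset[of _ "{..3 ^ m}"]) (auto simp: T_set_def)

lemma card_T_set_01:
  "2 * int (card (T_set 0 1 (2 * h + 1))) = 3 ^ (2 * h + 1) + (-1) ^ h - 2"
proof -
  let ?m = "2 * h + 1"
  let ?A = "\<lambda>r. {j. j < 3 ^ ?m \<and> w3 j mod 4 = r mod 4}"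
  \<comment> \<open>Of the two numbers below \<open>3 ^ ?m\<close> that \<open>T_set\<close> leaves
    out, 0 is counted and has to be subtracted. The top one has weight \<open>2 * ?m\<close>, which
    is 2 modulo 4 as \<open>?m\<close> is odd, and is not counted.\<close>
  have top: "w3 (3 ^ ?m - 1) mod 4 = 2"
    using w3_complement[of 0 ?m] by (simp, presburger)
  have "T_set 0 1 ?m = (?A 0 \<union> ?A 1) - {0}"
  proof (intro equalityI subsetI)
    fix j assume j: "j \<in> (?A 0 \<union> ?A 1) - {0}"
    then have "j \<noteq> 3 ^ ?m - 1" using top by auto
    then show "j \<in> T_set 0 1 ?m" using j by (auto simp: T_set_def)
  next
    fix j assume "j \<in> T_set 0 1 ?m"
    moreover have "(0::nat) < 3 ^ ?m" by simp
    ultimately show "j \<in> (?A 0 \<union> ?A 1) - {0}" unfolding T_set_def by auto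
  qed
  moreover have "card (?A 0 \<union> ?A 1) = w3_count 0 ?m + w3_count 1 ?m"
    unfolding w3_count_def by (rule card_Un_disjoint) auto
  moreover have "Suc (card ((?A 0 \<union> ?A 1) - {0})) = card (?A 0 \<union> ?A 1)"
    by (rule card_Suc_Diff1) simp_all
  ultimately have "card (T_set 0 1 ?m) + 1 = w3_count 0 ?m + w3_count 1 ?m"
    by simp
  then show ?thesis using w3_count_01[of h] by (simp only: flip: of_nat_add) (simp add: algebra_simps)
qed

section \<open>Independent sets and the shifting bound\<close>

text \<open>Linear independence of the functions that send \<open>i\<close> to \<open>b ^ i\<close>,
  restricted to \<open>S\<close>. With \<open>S\<close> the support of a word, \<open>card B\<close>
  bounds its weight from below.\<close>

definition indep_on :: "nat set \<Rightarrow> 'a::field set \<Rightarrow> bool" where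
  "indep_on S B \<longleftrightarrow>
     (\<forall>u. (\<forall>i\<in>S. (\<Sum>b\<in>B. u b * b ^ i) = 0) \<longrightarrow> (\<forall>b\<in>B. u b = 0))"

lemma indep_on_empty [simp]: "indep_on S {}"
  by (simp add: indep_on_def)

text \<open>Scaling multiplies the equation at \<open>i\<close> by the nonzero factor
  \<open>y ^ i\<close>.\<close>

lemma indep_on_scale:
  assumes "indep_on S B" "y \<noteq> 0"
  shows "indep_on S ((*) y ` B)"
  unfolding indep_on_def
proof (intro allI impI)
  fix u assume u: "\<forall>i\<in>S. (\<Sum>b\<in>(*) y ` B. u b * b ^ i) = 0"
  have inj: "inj_on ((*) y) B" using assms(2) by (auto intro!: inj_onI)
  have "(\<Sum>b\<in>B. u (y * b) * b ^ i) = 0" if "i \<in> S" for i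
  proof -
    have "y ^ i * (\<Sum>b\<in>B. u (y * b) * b ^ i) = (\<Sum>b\<in>B. u (y * b) * (y * b) ^ i)"
      by (simp add: sum_distrib_left power_mult_distrib mult_ac)
    also have "\<dots> = 0" using u that by (simp add: sum.reindex[OF inj])
    finally show ?thesis using assms(2) by simp
  qed
  then have "\<forall>b\<in>B. u (y * b) = 0"
    using assms(1) unfolding indep_on_def by (elim allE[of _ "\<lambda>b. u (y * b)"]) blast
  then show "\<forall>b\<in>(*) y ` B. u b = 0" by simp
qed

lemma poly_eq_sum_support:
  fixes c :: "'a::comm_semiring_1 poly"
  shows "poly c x = (\<Sum>i | coeff c i \<noteq> 0. coeff c i * x ^ i)"
  unfolding poly_altdef
  by (rule sum.mono_neutral_right) (auto intro: le_degree)

lemma finite_support [simp]: "finite {i. coeff c i \<noteq> 0}"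
  by (rule finite_subset[of _ "{..degree c}"]) (auto intro: le_degree)

text \<open>The word itself is a linear functional that kills the old characters but not the new one.\<close>

lemma indep_on_insert:
  assumes "indep_on {i. coeff c i \<noteq> 0} B" "finite B"
    and "\<And>b. b \<in> B \<Longrightarrow> poly c b = 0" "poly c x \<noteq> 0"
  shows "indep_on {i. coeff c i \<noteq> 0} (insert x B)"
  unfolding indep_on_def
proof (intro allI impI)
  let ?S = "{i. coeff c i \<noteq> 0}"
  fix u assume u: "\<forall>i\<in>?S. (\<Sum>b\<in>insert x B. u b * b ^ i) = 0"
  have x: "x \<notin> B" using assms(3,4) by auto
  have "u x * poly c x = (\<Sum>b\<in>insert x B. u b * poly c b)"
    using x assms(2,3) by simp
  also have "\<dots> = (\<Sum>b\<in>insert x B. \<Sum>i\<in>?S. coeff c i * (u b * b ^ i))"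
    by (simp add: poly_eq_sum_support sum_distrib_left mult_ac)
  also have "\<dots> = (\<Sum>i\<in>?S. coeff c i * (\<Sum>b\<in>insert x B. u b * b ^ i))"
    by (subst sum.swap) (simp add: sum_distrib_left)
  also have "\<dots> = 0" using u by simp
  finally have ux: "u x = 0" using assms(4) by simp
  then have "\<forall>i\<in>?S. (\<Sum>b\<in>B. u b * b ^ i) = 0" using u x assms(2) by simp
  then show "\<forall>b\<in>insert x B. u b = 0" using assms(1) ux by (auto simp: indep_on_def)
qed

text \<open>Over a finite field the comparison of dimensions becomes a count: independence makes the
  linear map from coefficient families on \<open>B\<close> to values on \<open>S\<close>
  injective.\<close>

lemma card_le_if_indep_on:
  fixes B :: "'a::{finite,field} set"
  assumes "indep_on S B" "finite S"
  shows "card B \<le> card S"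
proof -
  let ?f = "\<lambda>u. \<lambda>i\<in>S. \<Sum>b\<in>B. u b * b ^ i"
  have "inj_on ?f (B \<rightarrow>\<^sub>E UNIV)"
  proof (rule inj_onI)
    fix u v assume uv: "u \<in> B \<rightarrow>\<^sub>E UNIV" "v \<in> B \<rightarrow>\<^sub>E UNIV" "?f u = ?f v"
    have "\<forall>i\<in>S. (\<Sum>b\<in>B. (u b - v b) * b ^ i) = 0"
    proof
      fix i assume "i \<in> S"
      then show "(\<Sum>b\<in>B. (u b - v b) * b ^ i) = 0"
        using fun_cong[OF uv(3), of i] by (simp add: left_diff_distrib sum_subtractf)
    qed
    then have "\<forall>b\<in>B. u b - v b = 0" 
      using assms(1) unfolding indep_on_def by (elim allE[of _ "\<lambda>b. u b - v b"]) blast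
    then show "u = v" using uv by (intro PiE_ext) auto
  qed
  moreover have "?f ` (B \<rightarrow>\<^sub>E UNIV) \<subseteq> (S \<rightarrow>\<^sub>E UNIV)" by auto
  moreover have "finite (S \<rightarrow>\<^sub>E (UNIV :: 'a set))" using assms(2) by (intro finite_PiE) auto
  ultimately have "card (B \<rightarrow>\<^sub>E (UNIV :: 'a set)) \<le> card (S \<rightarrow>\<^sub>E (UNIV :: 'a set))"
    by (rule card_inj_on_le)
  then have "CARD('a) ^ card B \<le> CARD('a) ^ card S"
    using assms(2) by (simp add: card_PiE)
  moreover have "card {0, 1 :: 'a} \<le> CARD('a)" by (intro card_mono) auto
  then have "1 < CARD('a)" by simp
  ultimately show ?thesis by (simp add: power_increasing_iff)
qed

text \<open>A BCH bound. The zeros just before the first nonzero term of the progression, together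
  with that term, form an independent set.\<close>

lemma hamming_weight_ge_progression:
  fixes c :: "'a::{finite,field} poly"
  assumes y: "y \<noteq> 0" and zero: "\<And>i. i < L \<Longrightarrow> poly c (x * y ^ i) = 0"
    and nonzero: "poly c (x * y ^ t) \<noteq> 0"
  shows "L < hamming_weight c"
proof -
  let ?S = "{i. coeff c i \<noteq> 0}"
  define t0 where "t0 = (LEAST t. poly c (x * y ^ t) \<noteq> 0)"
  have t0: "poly c (x * y ^ t0) \<noteq> 0" unfolding t0_def using nonzero by (rule LeastI)
  have less: "poly c (x * y ^ i) = 0" if "i < t0" for i
    using not_less_Least[of i "\<lambda>t. poly c (x * y ^ t) \<noteq> 0"] that by (auto simp: t0_def)
  have L: "L \<le> t0" using zero t0 by (metis not_le)
  define B where "B k = (\<lambda>i. x * y ^ (t0 - i)) ` {..k}" for k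
  have "indep_on ?S (B k) \<and> card (B k) = Suc k" if "k \<le> t0" for k
    using that
  proof (induction k)
    case 0
    have "indep_on ?S (insert (x * y ^ t0) {})" using t0 by (intro indep_on_insert) auto
    then show ?case by (simp add: B_def)
  next
    \<comment> \<open>Dividing by \<open>y\<close> moves \<open>B k\<close> onto zeros of
      \<open>c\<close>, so the nonzero term \<open>x * y ^ t0\<close> can be added again, and it is
      new.\<close>
    case (Suc k)
    let ?B = "(*) (inverse y) ` B k"
    have B: "?B = (\<lambda>i. x * y ^ (t0 - Suc i)) ` {..k}"
      unfolding B_def image_image
    proof (intro image_cong refl)
      fix i assume "i \<in> {..k}"
      then have "t0 - i = Suc (t0 - Suc i)" using Suc.prems by simp
      then show "inverse y * (x * y ^ (t0 - i)) = x * y ^ (t0 - Suc i)"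
        using y by (simp add: mult_ac)
    qed
    have eq: "B (Suc k) = insert (x * y ^ t0) ?B"
      unfolding B by (simp add: B_def atMost_Suc_eq_insert_0 image_image)
    have roots: "poly c b = 0" if "b \<in> ?B" for b
      using that less Suc.prems unfolding B by auto
    have ind: "indep_on ?S ?B" using Suc y by (intro indep_on_scale) auto
    have "inj_on ((*) (inverse y)) (B k)" using y by (auto intro!: inj_onI)
    then have "card ?B = Suc k" using Suc by (simp add: card_image)
    moreover have "x * y ^ t0 \<notin> ?B" using roots t0 by blast
    moreover have "indep_on ?S (B (Suc k))"
      unfolding eq by (rule indep_on_insert) (use ind roots t0 in auto)
    ultimately show ?case by (simp add: eq)
  qed
  from this[OF L] show ?thesis
    using card_le_if_indep_on[of ?S "B L"] by (auto simp: hamming_weight_def)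
qed

text \<open>A list of pairs \<open>(s, b)\<close>, last step first, builds a set of exponents modulo \<open>n\<close>: each step
  shifts the set built so far by \<open>s\<close> and adds \<open>b\<close>.\<close>

fun shift_chain :: "nat \<Rightarrow> (nat \<times> nat) list \<Rightarrow> nat list" where
  "shift_chain n [] = []"
| "shift_chain n ((s, b) # ps) = b # map (\<lambda>a. (a + s) mod n) (shift_chain n ps)"

text \<open>\<open>Z\<close> lists exponents of known zeros, \<open>N\<close> exponents of known
  nonzeros. With lists, concrete chains are checked by simplification.\<close>

fun shift_chain_valid :: "nat \<Rightarrow> nat list \<Rightarrow> nat list \<Rightarrow> (nat \<times> nat) list \<Rightarrow> bool" where
  "shift_chain_valid n Z N [] \<longleftrightarrow> True"
| "shift_chain_valid n Z N ((s, b) # ps) \<longleftrightarrow>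
     b \<in> set N \<and> (\<forall>a \<in> set (shift_chain n ps). (a + s) mod n \<in> set Z) \<and>
     shift_chain_valid n Z N ps"

lemma power_mod_order:
  fixes x :: "'a::monoid_mult"
  assumes "x ^ n = 1"
  shows "x ^ (k mod n) = x ^ k"
proof -
  have "x ^ k = x ^ (n * (k div n) + k mod n)" by simp
  also have "\<dots> = x ^ (k mod n)" unfolding power_add power_mult by (simp add: assms)
  finally show ?thesis ..
qed

text \<open>Each step scales an independent set by \<open>x ^ s\<close> onto zeros of
  \<open>c\<close> and adds a nonzero, so it gains exactly one element.\<close>

lemma hamming_weight_ge_shift_chain:
  fixes c :: "'a::{finite,field} poly"
  assumes "shift_chain_valid n Z N ps" and order: "x ^ n = 1" "n > 0"
    and zero: "\<And>j. j \<in> set Z \<Longrightarrow> poly c (x ^ j) = 0"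
    and nonzero: "\<And>j. j \<in> set N \<Longrightarrow> poly c (x ^ j) \<noteq> 0"
  shows "length ps \<le> hamming_weight c"
proof -
  let ?S = "{i. coeff c i \<noteq> 0}" and ?B = "\<lambda>ps. (\<lambda>j. x ^ j) ` set (shift_chain n ps)"
  have x: "x \<noteq> 0" using order by (metis not_gr_zero power_0_left zero_neq_one)
  have "indep_on ?S (?B ps) \<and> card (?B ps) = length ps" if "shift_chain_valid n Z N ps" for ps
    using that
  proof (induction ps)
    case (Cons p ps)
    obtain s b where p: "p = (s, b)" by force
    let ?C = "(*) (x ^ s) ` ?B ps"
    have C: "?C = (\<lambda>j. x ^ ((j + s) mod n)) ` set (shift_chain n ps)"
      unfolding image_image by (simp add: power_mod_order[OF order(1)] power_add mult.commute)
    have eq: "?B (p # ps) = insert (x ^ b) ?C"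
      unfolding C by (simp add: p image_image)
    have roots: "poly c z = 0" if "z \<in> ?C" for z
      using that Cons.prems zero unfolding C by (auto simp: p)
    have b: "poly c (x ^ b) \<noteq> 0" using Cons.prems nonzero by (simp add: p)
    have IH: "indep_on ?S (?B ps)" "card (?B ps) = length ps"
      using Cons by (auto simp: p)
    have ind: "indep_on ?S ?C" using IH x by (intro indep_on_scale) auto
    have "inj_on ((*) (x ^ s)) (?B ps)" using x by (auto intro!: inj_onI)
    then have "card ?C = length ps" using IH by (simp add: card_image)
    moreover have "x ^ b \<notin> ?C" using roots b by blast
    moreover have "indep_on ?S (?B (p # ps))"
      unfolding eq by (rule indep_on_insert) (use ind roots b in auto)
    ultimately show ?case unfolding eq by simp
  qed simp
  from this[OF assms(1)] show ?thesis
    using card_le_if_indep_on[of ?S "?B ps"] by (simp add: hamming_weight_def)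
qed

section \<open>Finite fields of characteristic 3\<close>

text \<open>Translation by 1 permutes the ring, hence preserves the sum of all elements, but adds
  \<open>CARD('a)\<close> to it.\<close>

lemma of_nat_CARD_eq_0: "of_nat CARD('a) = (0 :: 'a::{finite,ring_1})"
proof -
  have "(\<Sum>x\<in>UNIV. x + 1) = (\<Sum>x\<in>(UNIV :: 'a set). x)"
    by (rule sum.reindex_bij_witness[of _ "\<lambda>x. x - 1" "\<lambda>x. x + 1"]) auto
  then show ?thesis by (simp add: sum.distrib)
qed

lemma CHAR_eq_3:
  assumes "CARD('a::{finite,field}) = 3 ^ m"
  shows "CHAR('a) = 3"
proof -
  have "(3 :: 'a) ^ m = 0" using of_nat_CARD_eq_0[where 'a = 'a] by (simp add: assms)
  then have "of_nat 3 = (0 :: 'a)" by simp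
  then have "CHAR('a) dvd 3" by (simp only: of_nat_eq_0_iff_char_dvd)
  moreover have "prime (3 :: nat)" by simp
  moreover have "CHAR('a) \<noteq> 1" by simp
  ultimately show ?thesis by (auto simp: prime_nat_iff)
qed

section \<open>The Frobenius map and the prime subfield\<close>

context
  assumes char: "CHAR('a::field) = 3"
begin

lemma three_eq_0: "(3 :: 'a) = 0"
  using of_nat_CHAR[where 'a = 'a] by (simp add: char)

lemma two_neq_0: "(2 :: 'a) \<noteq> 0"
proof
  assume "(2 :: 'a) = 0"
  then have "(3 :: 'a) - 2 = 0" using three_eq_0 by simp
  then show False by simp
qed

lemma cube_sum: "(\<Sum>i\<in>A. f i :: 'a) ^ 3 = (\<Sum>i\<in>A. f i ^ 3)"
  by (rule freshmans_dream_sum) (simp_all add: char)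

lemma cube_eq_iff: "(x :: 'a) ^ 3 = y ^ 3 \<longleftrightarrow> x = y"
proof
  assume xy: "x ^ 3 = y ^ 3"
  have "x ^ 3 = ((x - y) + y) ^ 3" by simp
  also have "\<dots> = (x - y) ^ 3 + y ^ 3"
    by (rule freshmans_dream) (simp_all add: char)
  finally have "(x - y) ^ 3 = 0" using xy by simp
  then show "x = y" by simp
qed simp

lemma prime_subfield_eq: "(prime_subfield :: 'a set) = {0, 1, 2}"
proof (intro equalityI subsetI)
  fix x :: 'a assume "x \<in> prime_subfield"
  then obtain i :: int where i: "x = of_int i" by (auto simp: prime_subfield_def)
  have "of_int i = (of_int (3 * (i div 3) + i mod 3) :: 'a)" by simp
  also have "\<dots> = of_int (i mod 3)"
    by (simp only: of_int_add of_int_mult of_int_numeral three_eq_0 mult_zero_left add_0_left)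
  finally have x: "x = of_int (i mod 3)" by (simp add: i)
  have "i mod 3 = 0 \<or> i mod 3 = 1 \<or> i mod 3 = 2" by presburger
  then show "x \<in> {0, 1, 2}" unfolding x by auto
next
  fix x :: 'a assume "x \<in> {0, 1, 2}"
  then have "x = of_int 0 \<or> x = of_int 1 \<or> x = of_int 2" by auto
  then show "x \<in> prime_subfield" unfolding prime_subfield_def by blast
qed

lemma card_prime_subfield: "card (prime_subfield :: 'a set) = 3"
proof -
  have "(1 :: 'a) \<noteq> 2" by (metis add_cancel_right_right one_add_one zero_neq_one)
  then show ?thesis using two_neq_0 by (simp add: prime_subfield_eq)
qed

text \<open>In characteristic 3, \<open>x ^ 3 - x\<close> factors as
  \<open>x * (x - 1) * (x - 2)\<close>.\<close>

lemma prime_subfield_iff: "(x :: 'a) \<in> prime_subfield \<longleftrightarrow> x ^ 3 = x"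
proof -
  have "x ^ 3 - x = x * (x - 1) * (x - 2) + 3 * (x ^ 2 - x)"
    by (simp add: power3_eq_cube power2_eq_square algebra_simps)
  then have "x ^ 3 - x = x * (x - 1) * (x - 2)" by (simp add: three_eq_0)
  moreover have "x ^ 3 = x \<longleftrightarrow> x ^ 3 - x = 0" by simp
  ultimately show ?thesis by (auto simp: prime_subfield_eq)
qed

lemma poly_cube:
  fixes c :: "'a poly"
  assumes "\<forall>i. coeff c i \<in> prime_subfield"
  shows "poly c (x ^ 3) = poly c x ^ 3"
proof -
  have "poly c x ^ 3 = (\<Sum>i\<le>degree c. (coeff c i * x ^ i) ^ 3)"
    by (simp add: poly_altdef cube_sum)
  also have "\<dots> = (\<Sum>i\<le>degree c. coeff c i ^ 3 * (x ^ 3) ^ i)"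
    by (simp add: power_mult_distrib mult.commute flip: power_mult)
  also have "\<dots> = poly c (x ^ 3)"
    using assms by (simp add: poly_altdef prime_subfield_iff)
  finally show ?thesis ..
qed

lemma coeff_map_cube: "coeff (map_poly (\<lambda>x. x ^ 3) p) i = (coeff p i :: 'a) ^ 3"
  by (simp add: coeff_map_poly)

lemma map_cube_mult:
  "map_poly (\<lambda>x. x ^ 3) (p * q) = map_poly (\<lambda>x. x ^ 3) p * map_poly (\<lambda>x. x ^ 3) (q :: 'a poly)"
  by (rule poly_eqI) (simp add: coeff_map_cube coeff_mult cube_sum power_mult_distrib)

lemma map_cube_prod:
  "map_poly (\<lambda>x. x ^ 3) (\<Prod>i\<in>A. f i :: 'a poly) = (\<Prod>i\<in>A. map_poly (\<lambda>x. x ^ 3) (f i))"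
  by (induction A rule: infinite_finite_induct) (simp_all add: map_cube_mult)

text \<open>As fixed points of a multiplicative map, polynomials over the prime subfield are easily
  multiplied and cancelled.\<close>

lemma map_cube_eq_iff:
  "map_poly (\<lambda>x. x ^ 3) p = (p :: 'a poly) \<longleftrightarrow> (\<forall>i. coeff p i \<in> prime_subfield)"
  by (simp add: poly_eq_iff coeff_map_cube prime_subfield_iff)

text \<open>Cubing is injective, so it permutes the finite set \<open>R\<close> and with it the
  linear factors.\<close>

lemma coeff_prod_roots_in_prime_subfield:
  assumes "finite R" "(\<lambda>x. x ^ 3) ` R \<subseteq> R"
  shows "\<forall>i. coeff (\<Prod>r\<in>R. [:- r, 1:] :: 'a poly) i \<in> prime_subfield"
  unfolding map_cube_eq_iff[symmetric]
proof -
  have inj: "inj_on (\<lambda>x :: 'a. x ^ 3) R" by (rule inj_onI) (simp add: cube_eq_iff)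
  then have im: "(\<lambda>x. x ^ 3) ` R = R" using assms by (intro endo_inj_surj)
  have "map_poly (\<lambda>x. x ^ 3) [:- r, 1:] = [:- (r ^ 3), 1 :: 'a:]" for r
    by (simp add: map_poly_pCons)
  then have "map_poly (\<lambda>x. x ^ 3) (\<Prod>r\<in>R. [:- r, 1:]) = (\<Prod>r\<in>R. [:- (r ^ 3), 1 :: 'a:])"
    by (simp add: map_cube_prod)
  also have "\<dots> = (\<Prod>r\<in>(\<lambda>x. x ^ 3) ` R. [:- r, 1:])"
    by (simp add: prod.reindex[OF inj])
  finally show "map_poly (\<lambda>x. x ^ 3) (\<Prod>r\<in>R. [:- r, 1:]) = (\<Prod>r\<in>R. [:- r, 1 :: 'a:])"
    by (simp only: im)
qed

text \<open>Multiplication by \<open>g\<close> is a bijection from the polynomials of degree below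
  \<open>k\<close> over the prime subfield onto the code.\<close>

lemma card_cyclic_code:
  fixes g :: "'a poly"
  assumes g: "\<forall>i. coeff g i \<in> prime_subfield" "g \<noteq> 0" and k: "degree g + k = n" "k > 0"
  shows "card (cyclic_code n g) = 3 ^ k"
proof -
  \<comment> \<open>Bounding coefficients instead of the degree keeps the zero polynomial and
    \<open>k = 0\<close> uniform.\<close>
  define P where
    "P k = {q :: 'a poly. (\<forall>i. coeff q i \<in> prime_subfield) \<and> (\<forall>i\<ge>k. coeff q i = 0)}" for k
  have "finite (P k) \<and> card (P k) = 3 ^ k" for k
  proof (induction k)
    case 0
    have "P 0 = {0}" by (auto simp: P_def poly_eq_iff prime_subfield_eq)
    then show ?case by simp
  next
    case (Suc k)
    have "P (Suc k) = (\<lambda>(a, q). pCons a q) ` (prime_subfield \<times> P k)"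
    proof (intro equalityI subsetI)
      fix q assume q: "q \<in> P (Suc k)"
      obtain a q' where q': "q = pCons a q'" by (cases q)
      have "coeff q 0 \<in> prime_subfield" "coeff q (Suc i) \<in> prime_subfield"
        "i \<ge> k \<Longrightarrow> coeff q (Suc i) = 0" for i
        using q by (auto simp: P_def)
      then have "(a, q') \<in> prime_subfield \<times> P k" unfolding q' by (auto simp: P_def)
      then show "q \<in> (\<lambda>(a, q). pCons a q) ` (prime_subfield \<times> P k)" unfolding q' by force
    qed (auto simp: P_def coeff_pCons split: nat.splits)
    moreover have "inj_on (\<lambda>(a, q). pCons a q) (prime_subfield \<times> P k)"
      by (auto intro!: inj_onI)
    moreover have "finite (prime_subfield :: 'a set)" by (simp add: prime_subfield_eq)
    ultimately show ?case
      using Suc by (simp add: card_image card_cartesian_product card_prime_subfield)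
  qed
  moreover have "cyclic_code n g = (*) g ` P k"
  proof (intro equalityI subsetI)
    fix c assume c: "c \<in> cyclic_code n g"
    then obtain q where q: "c = g * q" by (auto simp: cyclic_code_def)
    have "map_poly (\<lambda>x. x ^ 3) c = c" "map_poly (\<lambda>x. x ^ 3) g = g"
      using c g by (simp_all add: map_cube_eq_iff cyclic_code_def)
    \<comment> \<open>Frobenius fixes \<open>c\<close> and \<open>g\<close>; cancelling
      \<open>g\<close> shows that it fixes \<open>q\<close> too.\<close>
    then have "g * map_poly (\<lambda>x. x ^ 3) q = g * q" by (metis q map_cube_mult)
    then have "\<forall>i. coeff q i \<in> prime_subfield" using g(2) map_cube_eq_iff by auto
    moreover have "coeff q i = 0" if "i \<ge> k" for i
    proof (cases "q = 0")
      case False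
      then have "degree g + degree q < n"
        using c g(2) by (simp add: q cyclic_code_def degree_mult_eq)
      then show ?thesis using that k by (intro coeff_eq_0) linarith
    qed simp
    ultimately show "c \<in> (*) g ` P k" by (auto simp: P_def q)
  next
    fix c assume "c \<in> (*) g ` P k"
    then obtain q where c: "c = g * q" and q: "q \<in> P k" by auto
    have "degree q < k" using q k(2) by (intro degree_lessI) (auto simp: P_def)
    then have "degree c < n" using degree_mult_le[of g q] k unfolding c by linarith
    moreover have "map_poly (\<lambda>x. x ^ 3) c = c"
      using g(1) q by (simp add: c map_cube_mult map_cube_eq_iff[THEN iffD2] P_def)
    ultimately show "c \<in> cyclic_code n g" by (simp add: cyclic_code_def map_cube_eq_iff c)
  qed
  moreover have "inj_on ((*) g) (P k)" using g(2) by (auto intro!: inj_onI)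
  ultimately show ?thesis by (simp add: card_image)
qed

end

text \<open>The product consists of \<open>- q\<close> and a copy of \<open>q\<close> shifted by
  \<open>N\<close>, with disjoint supports.\<close>

lemma hamming_weight_double:
  fixes q :: "'a::comm_ring_1 poly"
  assumes "degree q < N"
  shows "hamming_weight ((monom 1 N - 1) * q) = 2 * hamming_weight q"
proof -
  let ?S = "{i. coeff q i \<noteq> 0}"
  have lt: "i < N" if "coeff q i \<noteq> 0" for i using assms le_degree[OF that] by simp
  have "coeff ((monom 1 N - 1) * q) i = (if i < N then - coeff q i else coeff q (i - N))" for i
    using lt[of i] by (auto simp: left_diff_distrib coeff_monom_mult)
  then have "{i. coeff ((monom 1 N - 1) * q) i \<noteq> 0} = ?S \<union> (\<lambda>i. i + N) ` ?S"
    using lt by (force simp: image_iff split: if_splits intro: exI[of _ "_ - N"])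
  moreover have "card (?S \<union> (\<lambda>i. i + N) ` ?S) = card ?S + card ((\<lambda>i. i + N) ` ?S)"
    by (rule card_Un_disjoint) (auto dest: lt)
  moreover have "card ((\<lambda>i. i + N) ` ?S) = card ?S" by (rule card_image) simp
  ultimately show ?thesis by (simp add: hamming_weight_def)
qed

section \<open>The code\<close>

locale ternary_field =
  fixes m :: nat and \<alpha> :: "'a::{finite,field}"
  assumes card: "CARD('a) = 3 ^ m" and m: "m \<ge> 1" and prim: "primitive_element \<alpha>"
begin

abbreviation n :: nat where "n \<equiv> 3 ^ m - 1"

lemma n_ge_2: "n \<ge> 2"
proof -
  have "(3::nat) ^ 1 \<le> 3 ^ m" using m by (intro power_increasing) auto
  then show ?thesis by simp
qed

lemma even_n: "even n"
  by simp

lemma char: "CHAR('a) = 3"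
  using card by (rule CHAR_eq_3)

lemma alpha_neq_0: "\<alpha> \<noteq> 0"
proof
  assume "\<alpha> = 0"
  then have "x \<noteq> 0 \<Longrightarrow> \<exists>i. x = 0 ^ i" for x :: 'a
    using prim unfolding primitive_element_def by blast
  then have "x \<in> {0, 1}" for x :: 'a by (metis insertCI power_0_left)
  then have "UNIV \<subseteq> {0, 1 :: 'a}" by blast
  then have "CARD('a) \<le> card {0, 1 :: 'a}" by (intro card_mono) auto
  then show False using card n_ge_2 by simp
qed

text \<open>Multiplication by \<alpha> permutes the nonzero elements, so their product absorbs the
  factor \<open>\<alpha> ^ n\<close>.\<close>

lemma alpha_power_n: "\<alpha> ^ n = 1"
proof -
  let ?U = "UNIV - {0 :: 'a}"
  have "card ?U = n" using card by (simp add: card_Diff_singleton)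
  then have "\<alpha> ^ n * \<Prod>?U = (\<Prod>x\<in>?U. \<alpha> * x)"
    by (simp add: prod.distrib)
  also have "\<dots> = \<Prod>?U"
    by (rule prod.reindex_bij_witness[of _ "\<lambda>x. x / \<alpha>" "\<lambda>x. \<alpha> * x"]) (use alpha_neq_0 in auto)
  finally have "\<alpha> ^ n * \<Prod>?U = 1 * \<Prod>?U" by simp
  moreover have "\<Prod>?U \<noteq> 0" by simp
  ultimately show ?thesis by (simp only: mult_cancel_right) simp
qed

lemma alpha_power_mod: "\<alpha> ^ (k mod n) = \<alpha> ^ k"
  using alpha_power_n by (rule power_mod_order)

lemma inj_on_alpha_power: "inj_on (\<lambda>i. \<alpha> ^ i) {..<n}"
proof (rule eq_card_imp_inj_on)
  have "(\<lambda>i. \<alpha> ^ i) ` {..<n} = UNIV - {0}"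
  proof (intro equalityI subsetI)
    fix x :: 'a assume "x \<in> UNIV - {0}"
    then obtain i where "x = \<alpha> ^ i" using prim unfolding primitive_element_def by auto
    then have "x = \<alpha> ^ (i mod n)" by (simp only: alpha_power_mod)
    moreover have "i mod n < n" using n_ge_2 by simp
    ultimately show "x \<in> (\<lambda>i. \<alpha> ^ i) ` {..<n}" by blast
  qed (use alpha_neq_0 in auto)
  then show "card ((\<lambda>i. \<alpha> ^ i) ` {..<n}) = card {..<n}"
    using card by (simp add: card_Diff_singleton)
qed simp

lemma card_alpha_powers: "A \<subseteq> {..<n} \<Longrightarrow> card ((\<lambda>i. \<alpha> ^ i) ` A) = card A"
  using inj_on_alpha_power by (intro card_image) (rule inj_on_subset)

lemma poly_eq_0_if_roots:
  assumes "A \<subseteq> {..<n}" "degree c < card A" "\<And>j. j \<in> A \<Longrightarrow> poly c (\<alpha> ^ j) = 0"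
  shows "c = 0"
proof (rule ccontr)
  assume c: "c \<noteq> 0"
  have "card A = card ((\<lambda>i. \<alpha> ^ i) ` A)" using assms(1) by (simp only: card_alpha_powers)
  also have "\<dots> \<le> card {x. poly c x = 0}"
    by (intro card_mono) (use assms(3) in auto)
  also have "\<dots> \<le> degree c" using c by (rule card_poly_roots_bound)
  finally show False using assms(2) by simp
qed

lemma T_set_subset: "T_set i1 i2 m \<subseteq> {..<n}"
  using n_ge_2 by (auto simp: T_set_def)

text \<open>Modulo \<open>n\<close>, multiplication by 3 rotates the \<open>m\<close> ternary digits
  cyclically and keeps their sum.\<close>

lemma T_set_times_3:
  assumes "j \<in> T_set i1 i2 m"
  shows "\<exists>k \<in> T_set i1 i2 m. \<alpha> ^ (3 * j) = \<alpha> ^ k"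
proof -
  obtain p where p: "m = Suc p" using m by (cases m) auto
  define a r where "a = j div 3 ^ p" and "r = j mod 3 ^ p"
  have j: "j = a * 3 ^ p + r" unfolding a_def r_def by (rule div_mult_mod_eq[symmetric])
  have r: "r < 3 ^ p" by (simp add: r_def)
  have "j < 3 * 3 ^ p" using assms n_ge_2 by (auto simp: T_set_def p)
  then have a: "a < 3" by (simp add: a_def less_mult_imp_div_less)
  have jn: "1 \<le> j" "j < 3 * 3 ^ p - 1" using assms n_ge_2 by (auto simp: T_set_def p)
  \<comment> \<open>The rotated number is \<open>n\<close> only if all digits are 2, that is for
    \<open>j = n\<close>, which \<open>T_set\<close> excludes.\<close>
  have "3 * r + a \<noteq> 3 * 3 ^ p - 1"
  proof
    assume eq: "3 * r + a = 3 * 3 ^ p - 1"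
    then have "a = 2" "r = 3 ^ p - 1" using r a by presburger+
    then show False using jn r by (simp add: j)
  qed
  moreover have "w3 (3 * r + a) = w3 j"
    using w3_cons[OF a, of r] w3_block[OF r, of a] a by (simp add: j w3_digit)
  moreover have "3 * r + a \<ge> 1"
    using jn(1) unfolding j by (cases "a = 0") auto
  ultimately have "3 * r + a \<in> T_set i1 i2 m"
    using assms r a by (auto simp: T_set_def p)
  moreover have "(n + 1) * a = 3 * 3 ^ p * a" by (simp add: p)
  then have "3 * j = n * a + (3 * r + a)"
    unfolding j by (simp only: algebra_simps mult_1_left)
  then have "\<alpha> ^ (3 * j) = \<alpha> ^ (3 * r + a)"
    using alpha_power_n by (simp only: power_add power_mult power_one mult_1_left)
  ultimately show ?thesis by blast
qed

lemma gen_poly_eq: "gen_poly \<alpha> i1 i2 m = (\<Prod>x\<in>(\<lambda>j. \<alpha> ^ j) ` T_set i1 i2 m. [:- x, 1:])"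
proof -
  have "inj_on (\<lambda>j. \<alpha> ^ j) (T_set i1 i2 m)"
    using inj_on_alpha_power T_set_subset by (rule inj_on_subset)
  then show ?thesis by (simp add: gen_poly_def prod.reindex)
qed

lemma coeff_gen_poly: "\<forall>i. coeff (gen_poly \<alpha> i1 i2 m) i \<in> prime_subfield"
  unfolding gen_poly_eq
proof (rule coeff_prod_roots_in_prime_subfield[OF char])
  show "(\<lambda>x. x ^ 3) ` (\<lambda>j. \<alpha> ^ j) ` T_set i1 i2 m \<subseteq> (\<lambda>j. \<alpha> ^ j) ` T_set i1 i2 m"
    using T_set_times_3 by (fastforce simp: mult.commute simp flip: power_mult)
qed simp

lemma gen_poly_neq_0: "gen_poly \<alpha> i1 i2 m \<noteq> 0"
  by (simp add: gen_poly_def)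

lemma degree_gen_poly: "degree (gen_poly \<alpha> i1 i2 m) = card (T_set i1 i2 m)"
  unfolding gen_poly_def by (subst degree_prod_eq_sum_degree) auto

lemma card_code:
  assumes "card (T_set i1 i2 m) + k = n" "k > 0"
  shows "card (cyclic_code n (gen_poly \<alpha> i1 i2 m)) = 3 ^ k"
  using assms by (intro card_cyclic_code[OF char] coeff_gen_poly gen_poly_neq_0)
    (simp_all add: degree_gen_poly)

lemma code_zero:
  assumes "c \<in> cyclic_code n (gen_poly \<alpha> i1 i2 m)" "j \<in> T_set i1 i2 m"
  shows "poly c (\<alpha> ^ j) = 0"
proof -
  have "poly (gen_poly \<alpha> i1 i2 m) (\<alpha> ^ j) = 0"
    using assms(2) by (force simp: gen_poly_def poly_prod)
  then show ?thesis using assms(1) by (auto simp: cyclic_code_def)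
qed

text \<open>The even powers of \<alpha> are the roots of \<open>monom 1 N - 1\<close> with
  \<open>N = n div 2\<close>, which therefore divides \<open>c\<close>. At odd powers this factor is
  -2, so the quotient has the same zeros there.\<close>

lemma double_word_if_zero_at_evens:
  assumes "degree c < n" "\<And>j. even j \<Longrightarrow> poly c (\<alpha> ^ j) = 0"
  obtains q where "hamming_weight c = 2 * hamming_weight q"
    "\<And>j. odd j \<Longrightarrow> poly q (\<alpha> ^ j) = 0 \<longleftrightarrow> poly c (\<alpha> ^ j) = 0"
proof -
  define N where "N = n div 2"
  have n: "n = 2 * N" and N: "N > 0" using even_n n_ge_2 by (auto simp: N_def)
  let ?p = "monom 1 N - 1 :: 'a poly"
  have deg: "degree ?p = N"
  proof -
    have "degree (monom 1 N + (- 1) :: 'a poly) = degree (monom 1 N :: 'a poly)"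
      using N by (intro degree_add_eq_left) (simp add: degree_monom_eq)
    then show ?thesis by (simp add: degree_monom_eq)
  qed
  then have p: "?p \<noteq> 0" using N by auto
  have pp: "poly ?p (\<alpha> ^ j) = (\<alpha> ^ N) ^ j - 1" for j
    by (simp add: poly_monom mult.commute flip: power_mult)
  have sq: "(\<alpha> ^ N) ^ 2 = 1" 
    using alpha_power_n unfolding power_mult[symmetric] n by (simp only: mult.commute)
  have "(0::nat) \<noteq> N" "N \<in> {..<n}" "0 \<in> {..<n}" unfolding n using N by auto
  then have "\<alpha> ^ N \<noteq> \<alpha> ^ 0" using inj_on_alpha_power by (metis inj_onD)
  then have half: "\<alpha> ^ N = -1" using sq by (simp add: power2_eq_1_iff)
  \<comment> \<open>The remainder has degree below \<open>N\<close> but vanishes at \<open>N\<close>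
    distinct even powers.\<close>
  have "c mod ?p = 0"
  proof (rule poly_eq_0_if_roots)
    show "(*) 2 ` {..<N} \<subseteq> {..<n}" unfolding n by auto
    have "card ((*) 2 ` {..<N}) = N" by (simp add: card_image inj_on_def)
    then show "degree (c mod ?p) < card ((*) 2 ` {..<N})"
      using degree_mod_less[OF p, of c] N by (auto simp: deg)
    fix j assume "j \<in> (*) 2 ` {..<N}"
    then have j: "even j" by auto
    then have "poly ?p (\<alpha> ^ j) = 0" unfolding pp half by simp
    moreover have "poly c (\<alpha> ^ j) = poly (c div ?p * ?p + c mod ?p) (\<alpha> ^ j)"
      by (simp only: div_mult_mod_eq)
    ultimately show "poly (c mod ?p) (\<alpha> ^ j) = 0"
      using assms(2)[OF j] by (metis add_0 mult_zero_right poly_add poly_mult)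
  qed
  then have c: "c = ?p * (c div ?p)" by (metis dvd_mult_div_cancel mod_eq_0_iff_dvd)
  let ?q = "c div ?p"
  have "degree ?q < N"
  proof (cases "?q = 0")
    case False
    then have "degree c = N + degree ?q" using c p deg by (metis degree_mult_eq)
    then show ?thesis using assms(1) unfolding n by simp
  qed (use N in simp)
  then have "hamming_weight c = 2 * hamming_weight ?q"
    using hamming_weight_double c by metis
  moreover have "poly ?q (\<alpha> ^ j) = 0 \<longleftrightarrow> poly c (\<alpha> ^ j) = 0" if "odd j" for j
  proof -
    have "poly ?p (\<alpha> ^ j) = -2" unfolding pp half using that by simp
    moreover have "poly c (\<alpha> ^ j) = poly ?p (\<alpha> ^ j) * poly ?q (\<alpha> ^ j)"
      by (subst c) simp
    ultimately show ?thesis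
      using two_neq_0[OF char] by (metis mult_eq_0_iff neg_equal_0_iff_equal)
  qed
  ultimately show thesis by (rule that)
qed

end

section \<open>Runs of zeros for odd \<open>m\<close>\<close>

locale ternary_field_odd = ternary_field +
  fixes h :: nat
  assumes m_eq: "m = 2 * h + 1" and h: "h \<ge> 1"
begin

text \<open>This says that 2 is a multiple of \<open>3 ^ k - 1\<close> modulo \<open>n\<close>. For
  \<open>k = h + 1\<close> the witness comes from
  \<open>3 ^ (2 * k) - 1 = 3 * n + 2\<close>.\<close>

lemma exists_power_eq_square:
  assumes "k = h \<or> k = h + 1"
  obtains s where "\<alpha> ^ ((3 ^ k - 1) * s) = \<alpha> ^ 2"
  using assms
proof
  assume k: "k = h + 1"
  have "(3::nat) * 3 ^ m = 3 ^ k * 3 ^ k"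
    by (simp add: k m_eq mult_2 flip: power_add power_Suc)
  moreover have "(3 ^ k - 1) * (3 ^ k + 1) = (3::nat) ^ k * 3 ^ k - 1" by (simp add: algebra_simps)
  moreover have "(1::nat) \<le> 3 ^ m" by simp
  ultimately have "(3 ^ k - 1) * (3 ^ k + 1) = n * 3 + 2" by linarith
  then have "\<alpha> ^ ((3 ^ k - 1) * (3 ^ k + 1)) = (\<alpha> ^ n) ^ 3 * \<alpha> ^ 2"
    by (simp only: power_add power_mult)
  then show thesis using alpha_power_n by (intro that) (simp only: power_one mult_1_left)
next
  assume k: "k = h"
  \<comment> \<open>Here the exponent is \<open>3 ^ m - 3 = n - 2\<close>, so \<beta> is the inverse
    of \<open>\<alpha> ^ 2\<close>, and its power \<open>n - 1\<close> inverts it back.\<close>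
  define \<beta> where "\<beta> = \<alpha> ^ ((3 ^ k - 1) * (3 * (3 ^ k + 1)))"
  have "(3::nat) ^ m = 3 * (3 ^ k * 3 ^ k)"
    by (simp add: k m_eq mult_2 flip: power_add)
  moreover have "(3 ^ k - 1) * (3 * (3 ^ k + 1)) = 3 * ((3::nat) ^ k * 3 ^ k) - 3"
    by (simp add: algebra_simps)
  moreover have "(1::nat) \<le> 3 ^ k * 3 ^ k" by simp
  ultimately have "(3 ^ k - 1) * (3 * (3 ^ k + 1)) + 2 = n" by linarith
  then have "\<beta> * \<alpha> ^ 2 = 1" using alpha_power_n by (simp add: \<beta>_def flip: power_add)
  moreover have \<beta>n: "\<beta> ^ n = 1"
    unfolding \<beta>_def power_mult[symmetric] mult.commute[of _ n]
    using alpha_power_n by (simp only: power_mult power_one)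
  have "Suc (n - 1) = n" using n_ge_2 by linarith
  then have "\<beta> * \<beta> ^ (n - 1) = 1" using \<beta>n by (simp only: flip: power_Suc)
  ultimately have "\<beta> ^ (n - 1) = \<alpha> ^ 2" by (metis mult_cancel_left mult_zero_left zero_neq_one)
  then show thesis using that[of "3 * (3 ^ k + 1) * (n - 1)"]
    by (simp add: \<beta>_def mult.assoc flip: power_mult)
qed

text \<open>Steps of \<open>3 ^ k - 1\<close> reach every exponent of the parity of
  \<open>b\<close>, so the progression containing the run also meets the nonzero at
  \<open>j\<close>.\<close>

lemma hamming_weight_gt_run:
  assumes k: "k = h \<or> k = h + 1"
    and zero: "\<And>i. 1 \<le> i \<Longrightarrow> i \<le> L \<Longrightarrow> poly c (\<alpha> ^ (b + (3 ^ k - 1) * i)) = 0"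
    and nonzero: "poly c (\<alpha> ^ j) \<noteq> 0" and parity: "even (j + b)"
  shows "L < hamming_weight c"
proof -
  define v where "v = (3::nat) ^ k - 1"
  obtain s where s: "\<alpha> ^ (v * s) = \<alpha> ^ 2"
    using exists_power_eq_square[OF k] unfolding v_def by metis
  have "odd (n - 1)" "even v" using n_ge_2 even_n by (auto simp: v_def)
  \<comment> \<open>The factor \<open>n - 1\<close> stands for -1 modulo \<open>n\<close>: this is
    the distance from the first term \<open>b + v\<close> to \<open>j\<close>, without
    subtraction.\<close>
  then have "even (j + (b + v) * (n - 1))" using parity by auto
  then obtain i where i: "j + (b + v) * (n - 1) = 2 * i" by blast
  have "\<alpha> ^ (b + v) * (\<alpha> ^ v) ^ (s * i) = \<alpha> ^ (b + v) * (\<alpha> ^ (v * s)) ^ i"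
    by (simp add: mult_ac flip: power_mult)
  also have "\<dots> = \<alpha> ^ (b + v) * \<alpha> ^ (j + (b + v) * (n - 1))"
    unfolding s i by (simp only: power_mult)
  also have "\<dots> = \<alpha> ^ (j + n * (b + v))"
  proof -
    obtain n' where "n = Suc n'" using n_ge_2 by (cases n) auto
    then have "b + v + (j + (b + v) * (n - 1)) = j + n * (b + v)"
      by (simp only: diff_Suc_1 mult_Suc mult.commute)
    then show ?thesis by (simp only: flip: power_add)
  qed
  also have "\<dots> = \<alpha> ^ j"
    using alpha_power_n by (simp only: power_add power_mult power_one mult_1_right)
  finally have "poly c (\<alpha> ^ (b + v) * (\<alpha> ^ v) ^ (s * i)) \<noteq> 0" using nonzero by simp
  moreover have "poly c (\<alpha> ^ (b + v) * (\<alpha> ^ v) ^ i) = 0" if "i < L" for i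
    using zero[folded v_def, of "Suc i"] that by (simp add: add.assoc flip: power_mult power_add)
  ultimately show ?thesis
    using alpha_neq_0 by (intro hamming_weight_ge_progression[of "\<alpha> ^ v"]) auto
qed

text \<open>The weight \<open>2 * k\<close> is 0 modulo 4 as \<open>k\<close> is even, and even for
  \<open>k = h + 1\<close> the largest multiple is only \<open>3 ^ m - 3 ^ h\<close>.\<close>

lemma even_multiple_in_T:
  assumes "even k" "k = h \<or> k = h + 1" "1 \<le> i" "i \<le> 3 ^ h"
  shows "(3 ^ k - 1) * i \<in> T_set 0 1 m"
proof -
  have k: "k \<ge> 1" using assms h by auto
  have le: "(3::nat) ^ k \<le> 3 ^ (h + 1)" "(3::nat) ^ h \<le> 3 ^ k"
    using assms by (auto intro!: power_increasing)
  have "w3 ((3 ^ k - 1) * i) = 2 * k"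
    using assms le by (intro w3_mult_power_minus_1) auto
  then have "w3 ((3 ^ k - 1) * i) mod 4 = 0" using assms(1) by auto
  moreover have "(3 ^ k - 1) * i \<le> 3 ^ m - 2"
  proof -
    have "(3 ^ k - 1) * i \<le> (3 ^ (h + 1) - 1) * 3 ^ h"
      using assms le by (intro mult_mono diff_le_mono) auto
    also have "\<dots> = 3 ^ (h + 1) * 3 ^ h - 3 ^ h" by (simp only: diff_mult_distrib mult_1_left)
    also have "(3::nat) ^ (h + 1) * 3 ^ h = 3 ^ m"
      unfolding power_add[symmetric] by (simp add: m_eq mult_2)
    also have "(3::nat) ^ 1 \<le> 3 ^ h" using h by (intro power_increasing) auto
    then have "3 ^ m - 3 ^ h \<le> (3::nat) ^ m - 2" by (intro diff_le_mono2) simp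
    finally show ?thesis .
  qed
  moreover have "(3::nat) ^ 1 \<le> 3 ^ k" using k by (intro power_increasing) auto
  then have "(3 ^ k - 1) * i \<ge> 1" using assms by (simp add: Suc_le_eq)
  ultimately show ?thesis by (simp add: T_set_def)
qed

text \<open>The bound on \<open>i\<close> keeps the multiple below \<open>2 * 3 ^ (2 * h)\<close>,
  so adding \<open>3 ^ (2 * h)\<close> raises the weight to \<open>2 * k + 1\<close> without carry
  or overflow.\<close>

lemma odd_multiple_in_T:
  assumes "even k" "k = h \<or> k = h + 1" "1 \<le> i" "i \<le> 2 * 3 ^ (h - 1)"
  shows "3 ^ (2 * h) + (3 ^ k - 1) * i \<in> T_set 0 1 m"
proof -
  obtain h' where h': "h = Suc h'" using h by (cases h) auto
  have le: "(3::nat) ^ k \<le> 3 ^ (h + 1)" "(3::nat) ^ h \<le> 3 ^ k" "i \<le> 3 ^ h"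
    using assms by (auto intro!: power_increasing simp: h')
  have w: "w3 ((3 ^ k - 1) * i) = 2 * k"
    using assms le by (intro w3_mult_power_minus_1) auto
  have "(3 ^ k - 1) * i \<le> (3 ^ (h + 1) - 1) * (2 * 3 ^ h')"
    using assms le by (intro mult_mono diff_le_mono) (auto simp: h')
  also have "\<dots> = 2 * (3 ^ (h + 1) * 3 ^ h') - 2 * 3 ^ h'"
    by (simp only: diff_mult_distrib mult_1_left mult.left_commute)
  also have "(3::nat) ^ (h + 1) * 3 ^ h' = 3 ^ (2 * h)"
    unfolding power_add[symmetric] by (simp add: h' mult_2)
  also have "2 * 3 ^ (2 * h) - 2 * 3 ^ h' \<le> 2 * (3::nat) ^ (2 * h) - 2" by (intro diff_le_mono2) simp
  finally have bound: "(3 ^ k - 1) * i \<le> 2 * 3 ^ (2 * h) - 2" .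
  have pos: "(0::nat) < 3 ^ (2 * h)" by simp
  have "w3 (3 ^ (2 * h) + (3 ^ k - 1) * i) = Suc (2 * k)"
    unfolding w[symmetric] by (rule w3_add_power) (use bound pos in linarith)
  moreover have "Suc (2 * k) mod 4 = 1" using assms(1) by (auto elim!: evenE)
  moreover have "3 ^ (2 * h) + (3 ^ k - 1) * i \<le> 3 ^ m - 2"
    using bound pos by (simp add: m_eq)
  moreover have "3 ^ (2 * h) + (3 ^ k - 1) * i \<ge> 1" using pos by linarith
  ultimately show ?thesis by (simp add: T_set_def)
qed

text \<open>Even and odd exponents form separate arithmetic progressions of step \<open>3 ^ k - 1\<close>. If \<open>c\<close>
  does not vanish on all even powers, the even run bounds its weight; otherwise \<open>c\<close> consists of two
  opposite halves and the odd run counts twice.\<close>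

lemma weight_gt:
  assumes c: "c \<in> cyclic_code n (gen_poly \<alpha> 0 1 m)" "c \<noteq> 0"
  shows "hamming_weight c > 3 ^ h + (if even h then 1 else 0) \<or>
         hamming_weight c \<ge> 4 * 3 ^ (h - 1) + 2"
proof -
  define k where "k = (if even h then h else h + 1)"
  have k: "even k" "k = h \<or> k = h + 1" by (auto simp: k_def)
  have deg: "degree c < n" using c(1) by (simp add: cyclic_code_def)
  show ?thesis
  proof (cases "\<exists>j. even j \<and> poly c (\<alpha> ^ j) \<noteq> 0")
    case True
    then obtain j where j: "even j" "poly c (\<alpha> ^ j) \<noteq> 0" by auto
    have "3 ^ h + (if even h then 1 else 0) < hamming_weight c"
    proof (rule hamming_weight_gt_run[OF k(2) _ j(2)])
      fix i :: nat assume i: "1 \<le> i" "i \<le> 3 ^ h + (if even h then 1 else 0)"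
      have "(3 ^ k - 1) * i \<in> T_set 0 1 m"
      proof (cases "i \<le> 3 ^ h")
        \<comment> \<open>For even \<open>h\<close> the run has one more term:
          \<open>(3 ^ h - 1) * (3 ^ h + 1) = 3 ^ (2 * h) - 1\<close> has weight
          \<open>4 * h\<close>.\<close>
        case False
        then have "even h" and ieq: "i = 3 ^ h + 1" using i by (auto split: if_splits)
        then have "k = h" by (simp add: k_def)
        moreover have "(3::nat) ^ (2 * h) = 3 ^ h * 3 ^ h" by (simp add: mult_2 power_add)
        ultimately have eq: "(3 ^ k - 1) * i = 3 ^ (2 * h) - 1 - 0"
          unfolding ieq by (simp only:) (simp add: algebra_simps)
        have "w3 (3 ^ (2 * h) - 1 - 0) = 2 * (2 * h)"
          using w3_complement[of 0 "2 * h"] by simp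
        then have "w3 (3 ^ (2 * h) - 1 - 0) mod 4 = 0" by simp
        moreover have "(3::nat) ^ 1 \<le> 3 ^ (2 * h)" using h by (intro power_increasing) auto
        ultimately show ?thesis unfolding eq by (auto simp: T_set_def m_eq)
      qed (use even_multiple_in_T k i in auto)
      then show "poly c (\<alpha> ^ (0 + (3 ^ k - 1) * i)) = 0" using code_zero[OF c(1)] by simp
    qed (use j in simp)
    then show ?thesis ..
  next
    case False
    then obtain q where q: "hamming_weight c = 2 * hamming_weight q"
      "\<And>j. odd j \<Longrightarrow> poly q (\<alpha> ^ j) = 0 \<longleftrightarrow> poly c (\<alpha> ^ j) = 0"
      using double_word_if_zero_at_evens[OF deg] by metis
    obtain j where j: "poly c (\<alpha> ^ j) \<noteq> 0"
      using poly_eq_0_if_roots[of "{..<n}" c] deg c(2) by auto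
    then have "odd j" using False by auto
    have "2 * 3 ^ (h - 1) < hamming_weight q"
    proof (rule hamming_weight_gt_run[OF k(2)])
      fix i :: nat assume i: "1 \<le> i" "i \<le> 2 * 3 ^ (h - 1)"
      have "poly c (\<alpha> ^ (3 ^ (2 * h) + (3 ^ k - 1) * i)) = 0"
        using code_zero[OF c(1) odd_multiple_in_T[OF k i]] .
      then show "poly q (\<alpha> ^ (3 ^ (2 * h) + (3 ^ k - 1) * i)) = 0" by (subst q(2)) auto
    qed (use q(2) j \<open>odd j\<close> in auto)
    then show ?thesis using q(1) by simp
  qed
qed

end

section \<open>The case \<open>m = 3\<close>\<close>

text \<open>The chains were found by computer search; each decides the vanishing of \<open>c\<close> on one more
  cyclotomic coset.\<close>

lemma (in ternary_field) weight_ge_7: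
  assumes m3: "m = 3" and c: "c \<in> cyclic_code n (gen_poly \<alpha> 0 1 m)" "c \<noteq> 0"
  shows "7 \<le> hamming_weight c"
proof (rule ccontr)
  assume lt: "\<not> 7 \<le> hamming_weight c"
  let ?z = "\<lambda>j. poly c (\<alpha> ^ j) = 0"
  have n: "n = 26" by (simp add: m3)
  have F3: "\<forall>i. coeff c i \<in> prime_subfield" using c(1) by (simp add: cyclic_code_def)
  \<comment> \<open>The zeros of a word over the prime subfield are closed under Frobenius, so they
    form a union of cyclotomic cosets modulo 26.\<close>
  have conj: "?z (3 * j mod 26) \<longleftrightarrow> ?z j" for j
  proof -
    have "\<alpha> ^ (3 * j mod 26) = \<alpha> ^ (3 * j)" using alpha_power_mod[of "3 * j"] unfolding n .
    also have "\<dots> = (\<alpha> ^ j) ^ 3" by (simp add: mult.commute flip: power_mult)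
    finally show ?thesis using poly_cube[OF char F3] by simp
  qed
  have shift: False
    if "shift_chain_valid 26 Z N ps" "7 \<le> length ps" "\<forall>j\<in>set Z. ?z j" "\<forall>j\<in>set N. \<not> ?z j" for Z N ps
    using hamming_weight_ge_shift_chain[OF that(1), of \<alpha> c] alpha_power_n that lt
    unfolding n by auto
  \<comment> \<open>These are the cosets of 1, 8, 14 and 17. Left to decide are those of 4, 0, 2, 5,
    13 and 7, in this order.\<close>
  have Z: "\<forall>j\<in>set [1, 3, 8, 9, 14, 16, 17, 20, 22, 23, 24, 25]. ?z j"
  proof -
    have "\<forall>j\<in>set [1, 3, 8, 9, 14, 16, 17, 20, 22, 23, 24, 25]. j \<in> T_set 0 1 m"
      by (simp only: list.set ball_simps T_set_def mem_Collect_eq m3) (simp add: w3.simps)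
    then show ?thesis using code_zero[OF c(1)] by blast
  qed
  have z4: "?z 4"
  proof (rule ccontr)
    assume a: "\<not> ?z 4"
    show False
      by (rule shift[where N = "[4, 10, 12]", OF _ _ Z, where ps =
            "[(21, 4), (2, 4), (11, 12), (6, 12), (25, 10), (5, 4), (0, 4)]"])
        (use a conj[of 4] conj[of 12] in auto)
  qed
  then have Z4: "\<forall>j\<in>set [1, 3, 4, 8, 9, 10, 12, 14, 16, 17, 20, 22, 23, 24, 25]. ?z j"
    using Z conj[of 4] conj[of 12] by simp
  \<comment> \<open>With 4 and 12 now zeros, the multiples 4, 8, ..., 24 of 4 form a run of six
    zeros next to 0.\<close>
  have z0: "?z 0"
  proof (rule ccontr)
    assume a: "\<not> ?z 0"
    show False
      by (rule shift[where N = "[0]", OF _ _ Z4, where ps =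
            "[(4, 0), (4, 0), (4, 0), (4, 0), (4, 0), (4, 0), (0, 0)]"])
        (use a in auto)
  qed
  then have Z0: "\<forall>j\<in>set [0, 1, 3, 4, 8, 9, 10, 12, 14, 16, 17, 20, 22, 23, 24, 25]. ?z j"
    using Z4 by simp
  have z2: "?z 2"
  proof (rule ccontr)
    assume a: "\<not> ?z 2"
    show False
      by (rule shift[where N = "[2]", OF _ _ Z0, where ps =
            "[(15, 2), (10, 2), (2, 2), (20, 2), (1, 2), (1, 2), (0, 2)]"])
        (use a in auto)
  qed
  then have Z2: "\<forall>j\<in>set [0, 1, 2, 3, 4, 6, 8, 9, 10, 12, 14, 16, 17, 18, 20, 22, 23, 24, 25]. ?z j"
    using Z0 conj[of 2] conj[of 6] by simp
  have z5: "?z 5"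
  proof (rule ccontr)
    assume a: "\<not> ?z 5"
    show False
      by (rule shift[where N = "[5]", OF _ _ Z2, where ps =
            "[(24, 5), (3, 5), (17, 5), (1, 5), (3, 5), (1, 5), (0, 5)]"])
        (use a in auto)
  qed
  then have Z5: "\<forall>j\<in>set [0, 1, 2, 3, 4, 5, 6, 8, 9, 10, 12, 14, 15, 16, 17, 18, 19, 20, 22, 23,
      24, 25]. ?z j"
    using Z2 conj[of 5] conj[of 15] by simp
  \<comment> \<open>The zeros 14, ..., 19 form a run of six directly after 13.\<close>
  have z13: "?z 13"
  proof (rule ccontr)
    assume a: "\<not> ?z 13"
    show False
      by (rule shift[where N = "[13]", OF _ _ Z5, where ps =
            "[(1, 13), (1, 13), (1, 13), (1, 13), (1, 13), (1, 13), (0, 13)]"])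
        (use a in auto)
  qed
  then have Z13: "\<forall>j\<in>set [0, 1, 2, 3, 4, 5, 6, 8, 9, 10, 12, 13, 14, 15, 16, 17, 18, 19, 20, 22,
      23, 24, 25]. ?z j"
    using Z5 by simp
  have z7: "?z 7"
  proof (rule ccontr)
    assume a: "\<not> ?z 7"
    show False
      by (rule shift[where N = "[7]", OF _ _ Z13, where ps =
            "[(1, 7), (1, 7), (5, 7), (1, 7), (1, 7), (1, 7), (0, 7)]"])
        (use a in auto)
  qed
  then have "\<forall>j\<in>set [0, 1, 2, 3, 4, 5, 6, 7, 8, 9, 10, 11, 12, 13, 14, 15, 16, 17, 18, 19, 20, 21,
      22, 23, 24, 25]. ?z j"
    using Z13 conj[of 7] conj[of 21] by simp
  moreover have "[0::nat, 1, 2, 3, 4, 5, 6, 7, 8, 9, 10, 11, 12, 13, 14, 15, 16, 17, 18, 19, 20, 21,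
      22, 23, 24, 25] = [0..<26]"
    by code_simp
  ultimately have "?z j" if "j \<in> {..<n}" for j
    using that unfolding n by (simp only:) simp
  moreover have "degree c < card {..<n}" using c(1) by (simp add: cyclic_code_def)
  ultimately show False using poly_eq_0_if_roots[of "{..<n}" c] c(2) by blast
qed

section \<open>Dimension and minimum distance\<close>

theorem theorem5:
  fixes m :: nat and \<alpha> :: "'a::{finite,field}"
  assumes "CARD('a) = 3 ^ m"
    and "m \<ge> 3" and "odd m"
    and "primitive_element \<alpha>"
  defines "n \<equiv> 3 ^ m - 1"
    and "C \<equiv> cyclic_code (3 ^ m - 1) (gen_poly \<alpha> 0 1 m)"
  shows "(m mod 4 = 1 \<longrightarrow>
            real (min_distance C) \<ge> (3 ^ ((m - 1) div 2) + 13) / 2 \<and> card C = 3 ^ (n div 2))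
       \<and> (m mod 4 = 3 \<longrightarrow>
            real (min_distance C) \<ge> (3 ^ ((m - 1) div 2) + 11) / 2 \<and> card C = 3 ^ ((n + 2) div 2))"
proof -
  define h where "h = (m - 1) div 2"
  have mh: "m = 2 * h + 1" and h1: "h \<ge> 1" using assms(2,3) by (auto simp: h_def)
  have even_h: "even h \<longleftrightarrow> m mod 4 = 1" and odd_h: "odd h \<longleftrightarrow> m mod 4 = 3"
    unfolding mh by presburger+
  interpret ternary_field_odd m \<alpha> h
    using assms(1,2,4) mh h1 by unfold_locales auto
  define k where "k = (if even h then n div 2 else (n + 2) div 2)"
  have cardT: "2 * int (card (T_set 0 1 m)) = int (3 ^ m) + (-1) ^ h - 2"
    using card_T_set_01[of h] unfolding mh[symmetric] by simp
  have n: "even n" "n \<ge> 2" "3 ^ m = n + 1" using even_n n_ge_2 by (simp_all add: n_def)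
  have "card (T_set 0 1 m) + k = n"
  proof (cases "even h")
    case True
    then have "2 * int (card (T_set 0 1 m)) = int n" using cardT unfolding n(3) by simp
    then show ?thesis using True n(1) unfolding k_def by simp
  next
    case False
    then have "2 * int (card (T_set 0 1 m)) = int n - 2" using cardT unfolding n(3) by simp
    then show ?thesis using False n(1) unfolding k_def by simp
  qed
  moreover have "k > 0" using n by (auto simp: k_def)
  ultimately have card_C: "card C = 3 ^ k" unfolding C_def n_def by (rule card_code)
  have "finite C" using card_C by (intro card_ge_0_finite) simp
  \<comment> \<open>The code must be finite and contain a nonzero word for \<open>Min\<close> to be
    attained.\<close>
  have "\<not> C \<subseteq> {0}"
  proof
    assume "C \<subseteq> {0}"
    then have "card C \<le> card {0 :: 'a poly}" by (intro card_mono) auto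
    moreover have "(3::nat) ^ 1 \<le> 3 ^ k" using \<open>k > 0\<close> by (intro power_increasing) auto
    ultimately show False using card_C by simp
  qed
  then have "min_distance C \<in> hamming_weight ` (C - {0})"
    unfolding min_distance_def using \<open>finite C\<close> by (intro Min_in) auto
  then obtain c where c: "c \<in> C" "c \<noteq> 0" "min_distance C = hamming_weight c" by auto
  note c' = c(1)[unfolded C_def] c(2)
  have bound: "3 ^ h + (if even h then 13 else 11) \<le> 2 * hamming_weight c"
  proof (cases "h = 1")
    case True
    \<comment> \<open>The target is \<open>3 + 11 = 2 * 7\<close>.\<close>
    then have "7 \<le> hamming_weight c" using weight_ge_7[OF _ c'] mh by simp
    then show ?thesis by (simp add: True)
  next
    case False
    then have "2 \<le> h" using h1 by simp
    then have h': "h = Suc (Suc (h - 2))" by simp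
    define h' where "h' = h - 2"
    note h' = h'[folded h'_def]
    \<comment> \<open>In terms of \<open>t\<close>, even \<open>h\<close> leaves
      \<open>18 * t + 4\<close> or \<open>24 * t + 4\<close> against \<open>9 * t + 13\<close>, odd
      \<open>h\<close> leaves \<open>18 * t + 2\<close> or \<open>24 * t + 4\<close> against
      \<open>9 * t + 11\<close>.\<close>
    define t where "t = (3::nat) ^ h'"
    have "3 \<le> t" if "odd h"
    proof -
      have "1 \<le> h'" using that h' by (cases "h' = 0") auto
      then have "(3::nat) ^ 1 \<le> 3 ^ h'" by (intro power_increasing) auto
      then show ?thesis by (simp add: t_def)
    qed
    moreover have "(3::nat) ^ h = 9 * t" "(3::nat) ^ (h - 1) = 3 * t" "1 \<le> t"
      unfolding t_def h' by simp_all
    ultimately show ?thesis using weight_gt[OF c'] by (cases "even h") (simp_all, linarith+)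
  qed
  have "real (3 ^ h + (if even h then 13 else 11)) \<le> real (2 * hamming_weight c)"
    using bound by (simp only: of_nat_le_iff)
  then have "real (min_distance C) \<ge> (3 ^ h + (if even h then 13 else 11)) / 2"
    using c(3) by (simp split: if_splits)
  then show ?thesis using card_C even_h odd_h unfolding k_def h_def by auto
qed

end
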